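(* Let $f,g,h,k$ be complex numbers with $g\neq0$, and let $(R_n)_{n\in\mathbb{Z}}$ be the two-sided sequence with $R_0=h$, $R_1=k$ and $R_{n+1}=fR_n+gR_{n-1}$ for all $n\in\mathbb{Z}$. Define $$S=\begin{cases}\left(k^{2}-gh^{2}-fhk\right)\dfrac{1-(-g)^{n}}{1+g} & \text{if } g\neq-1,\\[2mm] n\left(k^{2}-gh^{2}-fhk\right) & \text{if } g=-1.\end{cases}$$ Then for every integer $n$, $$\left(f^{2}-g^2+2g-1\right)\sum_{i=1}^{n}R_{i}^{2}=(R_{n+1}^{2}-k^{2})-g^{2}(R_{n}^{2}-h^{2})+2Sg,$$ and $$f\left(f^{2}-g^2+2g-1\right)\sum_{i=1}^{n}R_{i}R_{i-1}=(1-g)(R_{n+1}^{2}-k^{2})+g(g-1+f^{2})(R_{n}^{2}-h^{2})+S(1-f^{2}-g^{2}).$$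
   Context: The paper works with complex functions $f(z),g(z),h(z),k(z)$ evaluated at a fixed $z$. Since $g\neq0$, the sequence extends to negative indices via $R_{n-1}=(R_{n+1}-fR_n)/g$. For $n=0$ the sums are empty (equal to $0$); for $n<0$ the sum $\sum_{i=1}^{n}a_i$ is understood as $-\sum_{i=n+1}^{0}a_i$. *)

theory Defs
  imports Complex_Main
begin

(* The sum of a i for i from 1 to n, extended to n < 0 so that
   signed_sum a n - signed_sum a (n - 1) = a n holds for every integer n. *)
definition signed_sum :: "(int \<Rightarrow> complex) \<Rightarrow> int \<Rightarrow> complex" where
  "signed_sum a n =
     (if n \<ge> 0 then (\<Sum>i\<in>{1..n}. a i) else - (\<Sum>i\<in>{n+1..0}. a i))"

definition S_term :: "complex \<Rightarrow> complex \<Rightarrow> complex \<Rightarrow> complex \<Rightarrow> int \<Rightarrow> complex" where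
  "S_term f g h k n =
     (if g \<noteq> -1 then (k^2 - g * h^2 - f * h * k) * ((1 - (-g) powi n) / (1 + g))
      else of_int n * (k^2 - g * h^2 - f * h * k))"

end

theory Submission
  imports Defs
begin

text \<open>
  Both sides of each identity vanish at 0, so it suffices to compare their increments from
  m - 1 to m. The quantity R(m+1)^2 - g R(m)^2 - f R(m) R(m+1) is multiplied by -g when m
  increases by one, so it equals (-g)^m (k^2 - g h^2 - f h k), and this is exactly the
  increment of S from m to m + 1. After substituting the recurrence, the comparison of
  increments is a polynomial identity in f, g, R(m) and R(m-1).
\<close>

text \<open>Induction in both directions from 0: the one hypothesis \<open>step\<close> is read at
  \<open>i + 1\<close> when going up and at \<open>i\<close> when going down.\<close>

lemma int_fun_eqI:
  fixes F G :: "int \<Rightarrow> 'a::ab_group_add"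
  assumes zero: "F 0 = G 0"
    and step: "\<And>m. F m - F (m - 1) = G m - G (m - 1)"
  shows "F n = G n"
proof (induction n rule: int_induct[where k = 0])
  case base
  show ?case by (fact zero)
next
  case (step1 i)
  then show ?case using step[of "i + 1"] by simp
next
  case (step2 i)
  then show ?case using step[of i] by simp
qed

lemma signed_sum_0 [simp]: "signed_sum a 0 = 0"
  by (simp add: signed_sum_def)

lemma signed_sum_diff: "signed_sum a n - signed_sum a (n - 1) = a n"
\<comment> \<open>The split is at 1, not 0: for \<open>n = 0\<close> the term at
  \<open>n - 1\<close> already comes from the negative branch of \<open>signed_sum\<close>.\<close>
proof (cases "n \<ge> 1")
  case True
  then have "{1..n} = insert n {1..n - 1}" by auto
  with True show ?thesis by (simp add: signed_sum_def)
next
  case False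
  then have "{n..0} = insert n {n + 1..0}" by auto
  with False show ?thesis by (auto simp: signed_sum_def)
qed

lemma S_term_0 [simp]: "S_term f g h k 0 = 0"
  by (simp add: S_term_def)

text \<open>\<open>S_term\<close> is a geometric sum of ratio \<open>-g\<close> in closed form;
  \<open>g = -1\<close> is the case of ratio 1.\<close>

lemma S_term_diff:
  assumes "g \<noteq> 0"
  shows "S_term f g h k n - S_term f g h k (n - 1)
           = (-g) powi (n - 1) * (k^2 - g * h^2 - f * h * k)"
proof (cases "g = -1")
  case True
  then show ?thesis by (simp add: S_term_def algebra_simps)
next
  case False
  define D p where "D = k^2 - g * h^2 - f * h * k" and "p = (-g) powi (n - 1)"
  have "1 + g \<noteq> 0"
    using False by (metis add.commute add_eq_0_iff)
  moreover have "(-g) powi n = -g * p"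
    using power_int_add_1'[of "-g" "n - 1"] assms by (simp add: p_def)
  \<comment> \<open>The numerators differ by \<open>p + g * p\<close>, which cancels the denominator
    \<open>1 + g\<close>.\<close>
  ultimately have "D * ((1 - (-g) powi n) / (1 + g)) - D * ((1 - p) / (1 + g)) = p * D"
    by (simp add: divide_simps) (simp add: algebra_simps)
  with False show ?thesis by (simp add: S_term_def D_def p_def)
qed

text \<open>A Cassini identity: by the recurrence, the left side is \<open>g\<close> times
  \<open>R (n + 1) * R (n - 1) - (R n)^2\<close>, a determinant that each shift multiplies by
  \<open>-g\<close>.\<close>

lemma recurrence_invariant:
  fixes f g :: "'a::field" and R :: "int \<Rightarrow> 'a"
  assumes g: "g \<noteq> 0"
    and rec: "\<And>m. R (m + 1) = f * R m + g * R (m - 1)"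
  shows "(R (n + 1))^2 - g * (R n)^2 - f * R n * R (n + 1)
           = (-g) powi n * ((R 1)^2 - g * (R 0)^2 - f * R 0 * R 1)"
proof -
  define Q where "Q m = (R (m + 1))^2 - g * (R m)^2 - f * R m * R (m + 1)" for m
  have Q_step: "Q m = -g * Q (m - 1)" for m
    unfolding Q_def rec[of m] by (simp add: power2_eq_square algebra_simps)
  have "Q n = (-g) powi n * Q 0"
  proof (induction n rule: int_induct[where k = 0])
    case base
    show ?case by simp
  next
    case (step1 i)
    then show ?case
      using Q_step[of "i + 1"] power_int_add_1'[of "-g" i] g by simp
  next
    case (step2 i)
    \<comment> \<open>Going down, the common factor \<open>-g\<close> is cancelled, which is
      possible as \<open>g \<noteq> 0\<close>.\<close>
    have "(-g) powi i = -g * (-g) powi (i - 1)"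
      using power_int_add_1'[of "-g" "i - 1"] g by simp
    with step2 Q_step[of i] g show ?case by simp
  qed
  then show ?thesis by (simp add: Q_def)
qed

theorem theorem4p1:
  fixes f g h k :: complex and R :: "int \<Rightarrow> complex" and n :: int
  assumes "g \<noteq> 0"
    and "R 0 = h"
    and "R 1 = k"
    and "\<And>m. R (m + 1) = f * R m + g * R (m - 1)"
  shows "(f^2 - g^2 + 2 * g - 1) * signed_sum (\<lambda>i. (R i)^2) n
           = ((R (n + 1))^2 - k^2) - g^2 * ((R n)^2 - h^2) + 2 * S_term f g h k n * g
       \<and> f * (f^2 - g^2 + 2 * g - 1) * signed_sum (\<lambda>i. R i * R (i - 1)) n
           = (1 - g) * ((R (n + 1))^2 - k^2) + g * (g - 1 + f^2) * ((R n)^2 - h^2)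
             + S_term f g h k n * (1 - f^2 - g^2)"
proof -
  \<comment> \<open>Trading the power of \<open>-g\<close> for a quadratic form in
    \<open>R m\<close> and \<open>R (m - 1)\<close> also removes the case distinction on
    \<open>g\<close>.\<close>
  have S_diff: "S_term f g h k m - S_term f g h k (m - 1)
      = (R m)^2 - g * (R (m - 1))^2 - f * R (m - 1) * R m" for m
    using recurrence_invariant[of g R f "m - 1"] S_term_diff[of g f h k m] assms by simp
  have "(f^2 - g^2 + 2 * g - 1) * signed_sum (\<lambda>i. (R i)^2) n
      = ((R (n + 1))^2 - k^2) - g^2 * ((R n)^2 - h^2) + 2 * S_term f g h k n * g"
    (is "?F n = ?G n")
  proof (rule int_fun_eqI[where F = ?F and G = ?G])
    show "?F 0 = ?G 0" using assms by simp
  next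
    fix m
    have "?F m - ?F (m - 1) = (f^2 - g^2 + 2 * g - 1) * (R m)^2"
      by (simp only: right_diff_distrib [symmetric] signed_sum_diff)
    also have "\<dots> = ((R (m + 1))^2 - (R m)^2) - g^2 * ((R m)^2 - (R (m - 1))^2)
        + 2 * (S_term f g h k m - S_term f g h k (m - 1)) * g"
      \<comment> \<open>The factor \<open>2 * g\<close> on the \<open>S_term\<close> increment makes
        the cross terms and those in \<open>(R (m - 1))^2\<close> cancel.\<close>
      unfolding S_diff assms(4)[of m] by (simp add: power2_eq_square algebra_simps)
    also have "\<dots> = ?G m - ?G (m - 1)"
      by (simp add: algebra_simps)
    finally show "?F m - ?F (m - 1) = ?G m - ?G (m - 1)" .
  qed
  moreover have "f * (f^2 - g^2 + 2 * g - 1) * signed_sum (\<lambda>i. R i * R (i - 1)) n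
      = (1 - g) * ((R (n + 1))^2 - k^2) + g * (g - 1 + f^2) * ((R n)^2 - h^2)
        + S_term f g h k n * (1 - f^2 - g^2)"
    (is "?F n = ?G n")
  proof (rule int_fun_eqI[where F = ?F and G = ?G])
    show "?F 0 = ?G 0" using assms by simp
  next
    fix m
    have "?F m - ?F (m - 1) = f * (f^2 - g^2 + 2 * g - 1) * (R m * R (m - 1))"
      by (simp only: right_diff_distrib [symmetric] signed_sum_diff)
    also have "\<dots> = (1 - g) * ((R (m + 1))^2 - (R m)^2)
        + g * (g - 1 + f^2) * ((R m)^2 - (R (m - 1))^2)
        + (S_term f g h k m - S_term f g h k (m - 1)) * (1 - f^2 - g^2)"
      \<comment> \<open>Here both squares cancel and only the cross term remains.\<close>
      unfolding S_diff assms(4)[of m] by (simp add: power2_eq_square algebra_simps)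
    also have "\<dots> = ?G m - ?G (m - 1)"
      by (simp add: algebra_simps)
    finally show "?F m - ?F (m - 1) = ?G m - ?G (m - 1)" .
  qed
  ultimately show ?thesis ..
qed

end
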